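(* Let $G$ be a graph without isolated vertices. Then $$\gamma_{Zg}(G)\le \gamma_g(G),\ \gamma_{tg}(G)\le \gamma_{Lg}(G)\le \gamma_{LLg}(G),$$ that is, $\gamma_{Zg}(G)\le\gamma_g(G)\le\gamma_{Lg}(G)$, $\gamma_{Zg}(G)\le\gamma_{tg}(G)\le\gamma_{Lg}(G)$, and $\gamma_{Lg}(G)\le\gamma_{LLg}(G)$.
   Context: All graphs are finite and simple. For a vertex $v$ of a graph $G$, $N(v)$ is its open neighborhood and $N[v]=N(v)\cup\{v\}$ its closed neighborhood. Two players, Dominator and Staller, alternately select a vertex of $G$, with Dominator moving first (D-game). In the $i$-th move, after the moves $v_1,\dots,v_{i-1}$, the choice of a vertex $v_i$ is legal if - in the domination game: $N[v_i]\setminus\bigcup_{j=1}^{i-1}N[v_j]\neq\emptyset$; - in the total domination game: $N(v_i)\setminus\bigcup_{j=1}^{i-1}N(v_j)\neq\emptyset$; - in the Z-domination game: $N(v_i)\setminus\bigcup_{j=1}^{i-1}N[v_j]\neq\emptyset$; - in the L-domination game: $N[v_i]\setminus\bigcup_{j=1}^{i-1}N(v_j)\neq\emptyset$ and $v_i\neq v_j$ for all $j<i$; - in the LL-domination game: $N[v_i]\setminus\bigcup_{j=1}^{i-1}N(v_j)\neq\emptyset$. Each game ends when no legal move is available; its length is the total number of moves played (an unending play, possible in the LL-game since vertices may be repeated there, has infinite length). Dominator wants to minimize the length, Staller wants to maximize it. The lengths of the D-games on $G$ under optimal play by both players are denoted $\gamma_g(G)$ (domination game), $\gamma_{tg}(G)$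 (total domination game), $\gamma_{Zg}(G)$ (Z-domination game), $\gamma_{Lg}(G)$ (L-domination game), and $\gamma_{LLg}(G)$ (LL-domination game). *)

theory Defs
  imports "Graph_Theory.Pair_Digraph" "HOL-Library.Extended_Nat"
begin

text \<open>
  A finite simple graph is a \<open>pair_graph\<close>: finitely many vertices, with arcs forming a symmetric
  and irreflexive relation on them. Each edge is represented by its two orientations.
\<close>

definition open_nbhd :: "'a pair_pre_digraph \<Rightarrow> 'a \<Rightarrow> 'a set" where
  "open_nbhd G v = {u. (v, u) \<in> parcs G}"

definition closed_nbhd :: "'a pair_pre_digraph \<Rightarrow> 'a \<Rightarrow> 'a set" where
  "closed_nbhd G v = insert v (open_nbhd G v)"

definition no_isolated_vertices :: "'a pair_pre_digraph \<Rightarrow> bool" where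
  "no_isolated_vertices G \<longleftrightarrow> (\<forall>v \<in> pverts G. open_nbhd G v \<noteq> {})"

text \<open>
  The rules of a game are a predicate \<open>legal h v\<close>: the vertex \<open>v\<close> may be selected after the moves
  listed, in order of play, in \<open>h\<close>.
\<close>

definition dom_legal :: "'a pair_pre_digraph \<Rightarrow> 'a list \<Rightarrow> 'a \<Rightarrow> bool" where
  "dom_legal G h v \<longleftrightarrow>
     v \<in> pverts G \<and> closed_nbhd G v - (\<Union>u \<in> set h. closed_nbhd G u) \<noteq> {}"

definition total_legal :: "'a pair_pre_digraph \<Rightarrow> 'a list \<Rightarrow> 'a \<Rightarrow> bool" where
  "total_legal G h v \<longleftrightarrow>
     v \<in> pverts G \<and> open_nbhd G v - (\<Union>u \<in> set h. open_nbhd G u) \<noteq> {}"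

definition Z_legal :: "'a pair_pre_digraph \<Rightarrow> 'a list \<Rightarrow> 'a \<Rightarrow> bool" where
  "Z_legal G h v \<longleftrightarrow>
     v \<in> pverts G \<and> open_nbhd G v - (\<Union>u \<in> set h. closed_nbhd G u) \<noteq> {}"

definition L_legal :: "'a pair_pre_digraph \<Rightarrow> 'a list \<Rightarrow> 'a \<Rightarrow> bool" where
  "L_legal G h v \<longleftrightarrow>
     v \<in> pverts G \<and> closed_nbhd G v - (\<Union>u \<in> set h. open_nbhd G u) \<noteq> {} \<and> v \<notin> set h"

definition LL_legal :: "'a pair_pre_digraph \<Rightarrow> 'a list \<Rightarrow> 'a \<Rightarrow> bool" where
  "LL_legal G h v \<longleftrightarrow>
     v \<in> pverts G \<and> closed_nbhd G v - (\<Union>u \<in> set h. open_nbhd G u) \<noteq> {}"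

text \<open>
  A strategy prescribes a move for every history, legal whenever a legal move exists. It is also
  defined on histories that never arise with its owner to move; these values are never used.
\<close>

definition strategies :: "('a list \<Rightarrow> 'a \<Rightarrow> bool) \<Rightarrow> ('a list \<Rightarrow> 'a) set" where
  "strategies legal = {\<sigma>. \<forall>h. (\<exists>v. legal h v) \<longrightarrow> legal h (\<sigma> h)}"

text \<open>
  The history after \<open>n\<close> moves when Dominator, who moves first, follows \<open>\<sigma>\<close> and Staller follows
  \<open>\<tau>\<close>. If the game ends earlier, the history stays constant from then on.
\<close>

primrec play ::
  "('a list \<Rightarrow> 'a \<Rightarrow> bool) \<Rightarrow> ('a list \<Rightarrow> 'a) \<Rightarrow> ('a list \<Rightarrow> 'a) \<Rightarrow> nat \<Rightarrow> 'a list"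
where
  "play legal \<sigma> \<tau> 0 = []"
| "play legal \<sigma> \<tau> (Suc n) =
     (let h = play legal \<sigma> \<tau> n
      in if \<exists>v. legal h v then h @ [if even (length h) then \<sigma> h else \<tau> h] else h)"

definition play_length ::
  "('a list \<Rightarrow> 'a \<Rightarrow> bool) \<Rightarrow> ('a list \<Rightarrow> 'a) \<Rightarrow> ('a list \<Rightarrow> 'a) \<Rightarrow> enat"
where
  "play_length legal \<sigma> \<tau> = (SUP n. enat (length (play legal \<sigma> \<tau> n)))"

text \<open>
  The length under optimal play, as Dominator's minimax value. Taking the supremum over Staller's
  strategies outermost gives the same value: there are finitely many moves in each position, so
  the games are determined even though plays of the LL-game may be infinite.
\<close>

definition D_game_length :: "('a list \<Rightarrow> 'a \<Rightarrow> bool) \<Rightarrow> enat" where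
  "D_game_length legal =
     (INF \<sigma> \<in> strategies legal. SUP \<tau> \<in> strategies legal. play_length legal \<sigma> \<tau>)"

definition gamma_g :: "'a pair_pre_digraph \<Rightarrow> enat" where
  "gamma_g G = D_game_length (dom_legal G)"

definition gamma_tg :: "'a pair_pre_digraph \<Rightarrow> enat" where
  "gamma_tg G = D_game_length (total_legal G)"

definition gamma_Zg :: "'a pair_pre_digraph \<Rightarrow> enat" where
  "gamma_Zg G = D_game_length (Z_legal G)"

definition gamma_Lg :: "'a pair_pre_digraph \<Rightarrow> enat" where
  "gamma_Lg G = D_game_length (L_legal G)"

definition gamma_LLg :: "'a pair_pre_digraph \<Rightarrow> enat" where
  "gamma_LLg G = D_game_length (LL_legal G)"

end

theory Submission
  imports Defs
begin

text \<open>
  All five inequalities follow by the imagination strategy: Dominator imagines a second game,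
  follows an optimal strategy there, and copies each move of Staller into it. The real game is at
  least as covered as the imagined one; whenever Dominator's imagined move is not legal in the
  real game, it covers nothing new there, so that any legal move can be played instead. The only
  exception is an imagined move \<open>d\<close> of the domination game whose sole new vertex in the
  Z-domination game is \<open>d\<close> itself, where a neighbor of \<open>d\<close> does the job.
\<close>

text \<open>
  The history is given latest move first. The moves at even positions, which are Dominator's, are
  replaced by the answers of \<open>\<sigma>\<close> in the imagined game.
\<close>

primrec imagined :: "('a list \<Rightarrow> 'a) \<Rightarrow> 'a list \<Rightarrow> 'a list" where
  "imagined \<sigma> [] = []"
| "imagined \<sigma> (x # r) =
     imagined \<sigma> r @ [if even (length r) then \<sigma> (imagined \<sigma> r) else x]"

text \<open>Staller's moves are copied into the imagined play, so \<open>R\<close> persists and, by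
  \<open>R_Staller\<close>, the imagined game cannot end before the real one. The premise on
  \<open>\<sigma>\<close> is restricted to \<open>k = imagined \<sigma>' (rev h)\<close> because
  \<open>\<sigma>\<close> sees only the real history and has to rebuild the imagined one from
  it.\<close>

lemma play_length_simulation:
  assumes R0: "R [] []"
    and R_Staller: "\<And>h k s. R h k \<Longrightarrow> legal h s \<Longrightarrow> legal' k s \<and> R (h @ [s]) (k @ [s])"
    and \<sigma>': "\<sigma>' \<in> strategies legal'"
    and \<sigma>: "\<And>h k. R h k \<Longrightarrow> k = imagined \<sigma>' (rev h) \<Longrightarrow> (\<exists>v. legal h v) \<Longrightarrow> legal' k (\<sigma>' k)
      \<Longrightarrow> R (h @ [\<sigma> h]) (k @ [\<sigma>' k])"
    and \<tau>: "\<tau> \<in> strategies legal"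
  shows "\<exists>\<tau>' \<in> strategies legal'. play_length legal \<sigma> \<tau> \<le> play_length legal' \<sigma>' \<tau>'"
proof -
  let ?p = "play legal \<sigma> \<tau>"
  \<comment> \<open>\<open>\<tau>'\<close> sees only the imagined history, but with
    \<open>\<sigma>\<close> and \<open>\<tau>\<close> fixed the real history of the same length is
    known. The \<open>SOME\<close> branch makes \<open>\<tau>'\<close> a strategy on histories that
    this pair of plays never reaches.\<close>
  define \<tau>' where "\<tau>' k = (let s = \<tau> (?p (length k)) in
      if legal' k s then s else SOME v. legal' k v)" for k
  let ?q = "play legal' \<sigma>' \<tau>'"
  have strat: "\<tau>' \<in> strategies legal'"
    unfolding strategies_def \<tau>'_def by (auto simp: Let_def intro: someI)
  \<comment> \<open>Either both plays are still in step, or the real game is over and only the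
    comparison of lengths is kept, since the imagined play may go on.\<close>
  have inv: "(length (?p n) = n \<and> length (?q n) = n \<and> ?q n = imagined \<sigma>' (rev (?p n))
        \<and> R (?p n) (?q n))
      \<or> ((\<nexists>v. legal (?p n) v) \<and> length (?p n) \<le> length (?q n))" for n
  proof (induction n)
    case 0
    then show ?case using R0 by simp
  next
    case (Suc n)
    show ?case
    proof (cases "\<exists>v. legal (?p n) v")
      case False
      then have "?p (Suc n) = ?p n" by (simp add: Let_def)
      moreover have "length (?q n) \<le> length (?q (Suc n))" by (simp add: Let_def)
      moreover have "length (?p n) \<le> length (?q n)" using Suc by auto
      ultimately show ?thesis using False by (metis order_trans)
    next
      case True
      then have len: "length (?p n) = n" "length (?q n) = n"
        and im: "?q n = imagined \<sigma>' (rev (?p n))" and R: "R (?p n) (?q n)"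
        using Suc by auto
      \<comment> \<open>\<open>R_Staller\<close> is used here regardless of whose turn it is: any
        legal real move is legal in the imagined game.\<close>
      have ex': "\<exists>v. legal' (?q n) v" using True R R_Staller by blast
      have p: "?p (Suc n) = ?p n @ [if even n then \<sigma> (?p n) else \<tau> (?p n)]"
        using True len by (simp add: Let_def)
      have q: "?q (Suc n) = ?q n @ [if even n then \<sigma>' (?q n) else \<tau>' (?q n)]"
        using ex' len by (simp add: Let_def)
      note play.simps(2) [simp del]
      show ?thesis
      proof (cases "even n")
        case even: True
        have "legal' (?q n) (\<sigma>' (?q n))"
          using \<sigma>' ex' unfolding strategies_def by blast
        then have "R (?p (Suc n)) (?q (Suc n))"
          using \<sigma>[OF R im True] p q even by simp
        moreover have "?q (Suc n) = imagined \<sigma>' (rev (?p (Suc n)))"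
          using p q even im len by simp
        ultimately show ?thesis using p q len by simp
      next
        case odd: False
        have "legal (?p n) (\<tau> (?p n))"
          using \<tau> True unfolding strategies_def by blast
        then have s: "legal' (?q n) (\<tau> (?p n))"
            "R (?p n @ [\<tau> (?p n)]) (?q n @ [\<tau> (?p n)])"
          using R_Staller R by blast+
        have \<tau>'_eq: "\<tau>' (?q n) = \<tau> (?p n)"
          using \<tau>'_def[of "?q n"] s(1) len by (simp add: Let_def)
        have "?q (Suc n) = imagined \<sigma>' (rev (?p (Suc n)))"
          using p q odd im len \<tau>'_eq by simp
        then show ?thesis using p q len s(2) \<tau>'_eq odd by simp
      qed
    qed
  qed
  \<comment> \<open>The bound holds at each finite stage, so infinite plays need no separate
    treatment.\<close>
  have "length (?p n) \<le> length (?q n)" for n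
    using inv[of n] by auto
  then have "play_length legal \<sigma> \<tau> \<le> play_length legal' \<sigma>' \<tau>'"
    unfolding play_length_def by (intro SUP_mono) auto
  then show ?thesis using strat by blast
qed

text \<open>The reply \<open>x\<close> in \<open>R_Dominator\<close> depends on both histories; it
  becomes a strategy on \<open>h\<close> alone because \<open>h\<close> and \<open>\<sigma>'\<close>
  determine the imagined history.\<close>

lemma D_game_length_simulation:
  assumes R0: "R [] []"
    and R_Staller: "\<And>h k s. R h k \<Longrightarrow> legal h s \<Longrightarrow> legal' k s \<and> R (h @ [s]) (k @ [s])"
    and R_Dominator: "\<And>h k v d. R h k \<Longrightarrow> legal h v \<Longrightarrow> legal' k d
      \<Longrightarrow> \<exists>x. legal h x \<and> R (h @ [x]) (k @ [d])"
  shows "D_game_length legal \<le> D_game_length legal'"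
  unfolding D_game_length_def
proof (rule INF_mono)
  fix \<sigma>' assume \<sigma>': "\<sigma>' \<in> strategies legal'"
  define good where "good h x \<longleftrightarrow> legal h x \<and>
    R (h @ [x]) (imagined \<sigma>' (rev h) @ [\<sigma>' (imagined \<sigma>' (rev h))])" for h x
  \<comment> \<open>A good reply may be missing where \<open>R\<close> fails; there any legal move
    will do.\<close>
  define \<sigma> where "\<sigma> h = (if \<exists>x. good h x then SOME x. good h x else SOME x. legal h x)" for h
  have good: "good h (\<sigma> h)" if "\<exists>x. good h x" for h
    unfolding \<sigma>_def using that by (simp add: someI_ex)
  have "legal h (\<sigma> h)" if "\<exists>v. legal h v" for h
  proof (cases "\<exists>x. good h x")
    case True
    then show ?thesis using good unfolding good_def by blast
  next
    case False
    then have "\<sigma> h = (SOME x. legal h x)" by (simp add: \<sigma>_def)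
    then show ?thesis using that by (metis someI_ex)
  qed
  then have "\<sigma> \<in> strategies legal" unfolding strategies_def by blast
  moreover have "R (h @ [\<sigma> h]) (k @ [\<sigma>' k])"
    if "R h k" "k = imagined \<sigma>' (rev h)" "\<exists>v. legal h v" "legal' k (\<sigma>' k)" for h k
  proof -
    have "\<exists>x. good h x" using that R_Dominator unfolding good_def by blast
    then show ?thesis using good that(2) unfolding good_def by blast
  qed
  then have "(SUP \<tau>\<in>strategies legal. play_length legal \<sigma> \<tau>)
      \<le> (SUP \<tau>'\<in>strategies legal'. play_length legal' \<sigma>' \<tau>')"
    by (intro SUP_mono play_length_simulation[where R = R, OF R0 R_Staller \<sigma>'])
  ultimately show "\<exists>\<sigma>\<in>strategies legal. (SUP \<tau>\<in>strategies legal. play_length legal \<sigma> \<tau>)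
      \<le> (SUP \<tau>'\<in>strategies legal'. play_length legal' \<sigma>' \<tau>')"
    by blast
qed

abbreviation covered :: "('a \<Rightarrow> 'a set) \<Rightarrow> 'a list \<Rightarrow> 'a set" where
  "covered N h \<equiv> (\<Union>u \<in> set h. N u)"

lemma open_nbhd_subset_closed_nbhd: "open_nbhd G v \<subseteq> closed_nbhd G v"
  by (auto simp: closed_nbhd_def)

lemma gamma_Zg_le_gamma_g:
  assumes "pair_graph G" and "no_isolated_vertices G"
  shows "gamma_Zg G \<le> gamma_g G"
  unfolding gamma_Zg_def gamma_g_def
proof (rule D_game_length_simulation[where
      R = "\<lambda>h k. covered (closed_nbhd G) k \<subseteq> covered (closed_nbhd G) h"])
  fix h k v d
  assume R: "covered (closed_nbhd G) k \<subseteq> covered (closed_nbhd G) h"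
    and v: "Z_legal G h v" and d: "dom_legal G k d"
  interpret pair_graph G by fact
  \<comment> \<open>If \<open>d\<close> is illegal in the Z-game, all its neighbors are covered, and
    the cases differ in whether \<open>d\<close> itself is.\<close>
  consider "Z_legal G h d" | "closed_nbhd G d \<subseteq> covered (closed_nbhd G) h"
    | "open_nbhd G d \<subseteq> covered (closed_nbhd G) h" "d \<notin> covered (closed_nbhd G) h"
    using d unfolding Z_legal_def dom_legal_def closed_nbhd_def by blast
  then show "\<exists>x. Z_legal G h x
      \<and> covered (closed_nbhd G) (k @ [d]) \<subseteq> covered (closed_nbhd G) (h @ [x])"
  proof cases
    case 1
    then show ?thesis using R by (intro exI[of _ d]) auto
  next
    case 2
    then show ?thesis using R v by (intro exI[of _ v]) auto
  next
    case 3
    obtain x where dx: "(d, x) \<in> parcs G"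
      using assms(2) d unfolding no_isolated_vertices_def dom_legal_def open_nbhd_def by blast
    then have xd: "(x, d) \<in> parcs G" and x: "x \<in> pverts G"
      using arcs_symmetric in_arcsD2 by auto
    \<comment> \<open>The uncovered vertex \<open>d\<close> is itself a neighbor of
      \<open>x\<close>, which makes \<open>x\<close> legal; playing \<open>x\<close> then covers the
      rest of \<open>closed_nbhd G d\<close>.\<close>
    then have "Z_legal G h x" using 3 unfolding Z_legal_def open_nbhd_def by blast
    moreover have "d \<in> closed_nbhd G x" using xd by (simp add: closed_nbhd_def open_nbhd_def)
    then have "closed_nbhd G d \<subseteq> covered (closed_nbhd G) (h @ [x])"
      using 3(1) by (auto simp: closed_nbhd_def[of G d])
    ultimately show ?thesis using R by (intro exI[of _ x]) auto
  qed
next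
  fix h k s
  assume R: "covered (closed_nbhd G) k \<subseteq> covered (closed_nbhd G) h"
    and s: "Z_legal G h s"
  have "dom_legal G k s"
    using R s open_nbhd_subset_closed_nbhd[of G s] unfolding Z_legal_def dom_legal_def by blast
  moreover have "covered (closed_nbhd G) (k @ [s]) \<subseteq> covered (closed_nbhd G) (h @ [s])"
    using R by auto
  ultimately show "dom_legal G k s
      \<and> covered (closed_nbhd G) (k @ [s]) \<subseteq> covered (closed_nbhd G) (h @ [s])"
    by blast
qed simp

text \<open>Each game is measured by its own neighborhoods: a move covers at least as much in the
  Z-game, so copied moves preserve the inclusion.\<close>

lemma gamma_Zg_le_gamma_tg: "gamma_Zg G \<le> gamma_tg G"
  unfolding gamma_Zg_def gamma_tg_def
proof (rule D_game_length_simulation[where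
      R = "\<lambda>h k. covered (open_nbhd G) k \<subseteq> covered (closed_nbhd G) h"])
  fix h k v d
  assume R: "covered (open_nbhd G) k \<subseteq> covered (closed_nbhd G) h"
    and v: "Z_legal G h v" and d: "total_legal G k d"
  consider "Z_legal G h d" | "open_nbhd G d \<subseteq> covered (closed_nbhd G) h"
    using d unfolding Z_legal_def total_legal_def by blast
  then show "\<exists>x. Z_legal G h x
      \<and> covered (open_nbhd G) (k @ [d]) \<subseteq> covered (closed_nbhd G) (h @ [x])"
    using R v open_nbhd_subset_closed_nbhd[of G d]
    by cases (rule exI[of _ d], auto, rule exI[of _ v], auto)
next
  fix h k s
  assume R: "covered (open_nbhd G) k \<subseteq> covered (closed_nbhd G) h"
    and s: "Z_legal G h s"
  have "total_legal G k s"
    using R s open_nbhd_subset_closed_nbhd[of G s] unfolding Z_legal_def total_legal_def by blast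
  moreover have "covered (open_nbhd G) (k @ [s]) \<subseteq> covered (closed_nbhd G) (h @ [s])"
    using R open_nbhd_subset_closed_nbhd[of G s] by auto
  ultimately show "total_legal G k s
      \<and> covered (open_nbhd G) (k @ [s]) \<subseteq> covered (closed_nbhd G) (h @ [s])"
    by blast
qed simp

text \<open>
  Measuring coverage by closed neighborhoods even in the imagined L-domination game keeps Staller's
  copied moves from repeating a vertex there.
\<close>

lemma gamma_g_le_gamma_Lg: "gamma_g G \<le> gamma_Lg G"
  unfolding gamma_g_def gamma_Lg_def
proof (rule D_game_length_simulation[where
      R = "\<lambda>h k. covered (closed_nbhd G) k \<subseteq> covered (closed_nbhd G) h"])
  fix h k v d
  assume R: "covered (closed_nbhd G) k \<subseteq> covered (closed_nbhd G) h"
    and v: "dom_legal G h v" and d: "L_legal G k d"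
  consider "dom_legal G h d" | "closed_nbhd G d \<subseteq> covered (closed_nbhd G) h"
    using d unfolding dom_legal_def L_legal_def by blast
  then show "\<exists>x. dom_legal G h x
      \<and> covered (closed_nbhd G) (k @ [d]) \<subseteq> covered (closed_nbhd G) (h @ [x])"
    using R v by cases (rule exI[of _ d], auto, rule exI[of _ v], auto)
next
  fix h k s
  assume R: "covered (closed_nbhd G) k \<subseteq> covered (closed_nbhd G) h"
    and s: "dom_legal G h s"
  obtain w where w: "w \<in> closed_nbhd G s" "w \<notin> covered (closed_nbhd G) k"
    using s R unfolding dom_legal_def by (meson DiffE ex_in_conv subsetD)
  then have "w \<notin> covered (open_nbhd G) k"
    by (auto simp: closed_nbhd_def)
  then have "L_legal G k s"
    using s w unfolding dom_legal_def L_legal_def by blast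
  moreover have "covered (closed_nbhd G) (k @ [s]) \<subseteq> covered (closed_nbhd G) (h @ [s])"
    using R by auto
  ultimately show "L_legal G k s
      \<and> covered (closed_nbhd G) (k @ [s]) \<subseteq> covered (closed_nbhd G) (h @ [s])"
    by blast
qed simp

text \<open>A copied Staller move \<open>s\<close> cannot repeat a vertex of \<open>k\<close>:
  otherwise \<open>open_nbhd G s\<close> would be covered already, contradicting its legality in the
  total game.\<close>

lemma gamma_tg_le_gamma_Lg: "gamma_tg G \<le> gamma_Lg G"
  unfolding gamma_tg_def gamma_Lg_def
proof (rule D_game_length_simulation[where
      R = "\<lambda>h k. covered (open_nbhd G) k \<subseteq> covered (open_nbhd G) h"])
  fix h k v d
  assume R: "covered (open_nbhd G) k \<subseteq> covered (open_nbhd G) h"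
    and v: "total_legal G h v" and d: "L_legal G k d"
  consider "total_legal G h d" | "open_nbhd G d \<subseteq> covered (open_nbhd G) h"
    using d unfolding total_legal_def L_legal_def by blast
  then show "\<exists>x. total_legal G h x
      \<and> covered (open_nbhd G) (k @ [d]) \<subseteq> covered (open_nbhd G) (h @ [x])"
    using R v by cases (rule exI[of _ d], auto, rule exI[of _ v], auto)
next
  fix h k s
  assume R: "covered (open_nbhd G) k \<subseteq> covered (open_nbhd G) h"
    and s: "total_legal G h s"
  have "L_legal G k s"
    using R s open_nbhd_subset_closed_nbhd[of G s] unfolding total_legal_def L_legal_def by blast
  moreover have "covered (open_nbhd G) (k @ [s]) \<subseteq> covered (open_nbhd G) (h @ [s])"
    using R by auto
  ultimately show "L_legal G k s
      \<and> covered (open_nbhd G) (k @ [s]) \<subseteq> covered (open_nbhd G) (h @ [s])"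
    by blast
qed simp

lemma gamma_Lg_le_gamma_LLg: "gamma_Lg G \<le> gamma_LLg G"
  unfolding gamma_Lg_def gamma_LLg_def
proof (rule D_game_length_simulation[where
      R = "\<lambda>h k. covered (open_nbhd G) k \<subseteq> covered (open_nbhd G) h"])
  fix h k v d
  assume R: "covered (open_nbhd G) k \<subseteq> covered (open_nbhd G) h"
    and v: "L_legal G h v" and d: "LL_legal G k d"
  \<comment> \<open>The move \<open>d\<close> can fail to be legal in the L-game in two ways, as a
    repetition or for covering nothing new; in both, its neighbors are already covered.\<close>
  consider "L_legal G h d" | "open_nbhd G d \<subseteq> covered (open_nbhd G) h"
    using d open_nbhd_subset_closed_nbhd[of G d] unfolding L_legal_def LL_legal_def by blast
  then show "\<exists>x. L_legal G h x
      \<and> covered (open_nbhd G) (k @ [d]) \<subseteq> covered (open_nbhd G) (h @ [x])"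
    using R v by cases (rule exI[of _ d], auto, rule exI[of _ v], auto)
next
  fix h k s
  assume R: "covered (open_nbhd G) k \<subseteq> covered (open_nbhd G) h"
    and s: "L_legal G h s"
  have "LL_legal G k s"
    using R s unfolding L_legal_def LL_legal_def by blast
  moreover have "covered (open_nbhd G) (k @ [s]) \<subseteq> covered (open_nbhd G) (h @ [s])"
    using R by auto
  ultimately show "LL_legal G k s
      \<and> covered (open_nbhd G) (k @ [s]) \<subseteq> covered (open_nbhd G) (h @ [s])"
    by blast
qed simp

theorem theorem3p1:
  fixes G :: "'a pair_pre_digraph"
  assumes "pair_graph G"
    and "no_isolated_vertices G"
  shows "gamma_Zg G \<le> gamma_g G \<and> gamma_g G \<le> gamma_Lg G
       \<and> gamma_Zg G \<le> gamma_tg G \<and> gamma_tg G \<le> gamma_Lg G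
       \<and> gamma_Lg G \<le> gamma_LLg G"
  using gamma_Zg_le_gamma_g[OF assms] gamma_g_le_gamma_Lg gamma_Zg_le_gamma_tg
    gamma_tg_le_gamma_Lg gamma_Lg_le_gamma_LLg
  by blast

end
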